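(* For every pair of positive integers $s,t$ there exists a positive integer $C_{s,t}$ such that for every positive integer $r$, setting $n=C_{s,t}r$, every coloring of the edges of the complete bipartite graph $K_{n,n}$ with $r$ colors contains a monochromatic copy of $K_{s,t}$ or a rainbow copy of $K_{s,t}$.
   Context: An $r$-coloring of a graph assigns to each edge one of $r$ colors. A subgraph is monochromatic if all its edges have the same color, and rainbow if all its edges have pairwise distinct colors. *)

theory Defs
  imports "HOL-Library.FuncSet"
begin

record 'a ugraph =
  vertices :: "'a set"
  edges :: "'a set set"

definition simple_graph :: "'a ugraph \<Rightarrow> bool" where
  "simple_graph G \<longleftrightarrow> (\<forall>e \<in> edges G. e \<subseteq> vertices G \<and> card e = 2)"

definition subgraph :: "'a ugraph \<Rightarrow> 'a ugraph \<Rightarrow> bool" where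
  "subgraph F G \<longleftrightarrow> simple_graph F \<and> vertices F \<subseteq> vertices G \<and> edges F \<subseteq> edges G"

definition isomorphic :: "'a ugraph \<Rightarrow> 'b ugraph \<Rightarrow> bool" where
  "isomorphic G H \<longleftrightarrow>
     (\<exists>f. bij_betw f (vertices G) (vertices H) \<and> (\<lambda>e. f ` e) ` edges G = edges H)"

text \<open>A copy is not required to respect the two sides: in a copy of \<open>K\<^bsub>s,t\<^esub>\<close> inside
  \<open>K\<^bsub>n,n\<^esub>\<close>, the part of size \<open>s\<close> may lie on either side.\<close>

definition copy_in :: "'b ugraph \<Rightarrow> 'a ugraph \<Rightarrow> 'a ugraph \<Rightarrow> bool" where
  "copy_in H G F \<longleftrightarrow> subgraph F G \<and> isomorphic H F"

definition complete_bipartite :: "nat \<Rightarrow> nat \<Rightarrow> (nat + nat) ugraph" where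
  "complete_bipartite m n =
     \<lparr>vertices = Inl ` {..<m} \<union> Inr ` {..<n},
      edges = {{Inl i, Inr j} | i j. i < m \<and> j < n}\<rparr>"

text \<open>Not every colour has to be used.\<close>

definition edge_coloring :: "nat \<Rightarrow> 'a ugraph \<Rightarrow> ('a set \<Rightarrow> nat) \<Rightarrow> bool" where
  "edge_coloring r G c \<longleftrightarrow> c \<in> edges G \<rightarrow> {..<r}"

definition monochromatic :: "('a set \<Rightarrow> 'c) \<Rightarrow> 'a ugraph \<Rightarrow> bool" where
  "monochromatic c F \<longleftrightarrow> (\<forall>e \<in> edges F. \<forall>e' \<in> edges F. c e = c e')"

definition rainbow :: "('a set \<Rightarrow> 'c) \<Rightarrow> 'a ugraph \<Rightarrow> bool" where
  "rainbow c F \<longleftrightarrow> inj_on c (edges F)"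

end

theory Submission
  imports Defs
begin

text \<open>
  Put \<open>k = max s t\<close>. By averaging, \<open>O(1)\<close> vertices on one side that all send a positive
  proportion of their edges in the same colour span a monochromatic \<open>K\<^bsub>k,k\<^esub>\<close>. So
  without a monochromatic copy each colour is dense at only \<open>O(1)\<close> vertices, and as there are
  only \<open>r = n / C\<close> colours, all but a small fraction of the vertices see every colour rarely.
  On the remaining vertices a rainbow copy is found greedily: first choose left vertices such
  that any two of them see equal colours at few right vertices, then right vertices that avoid
  these coincidences and all colours used before.
\<close>

section \<open>Double counting, pigeonhole and greedy selection\<close>

text \<open>Count the pairs with \<open>R a b\<close> twice: each \<open>a\<close> in the set on the
  left accounts for at least \<open>y\<close> of them, each \<open>b\<close> for at most
  \<open>x\<close>.\<close>

lemma card_dense_mult_le: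
  fixes x y :: nat
  assumes "finite A" "finite B"
    and "\<And>b. b \<in> B \<Longrightarrow> card {a \<in> A. R a b} \<le> x"
  shows "card {a \<in> A. y \<le> card {b \<in> B. R a b}} * y \<le> card B * x"
proof -
  let ?A = "{a \<in> A. y \<le> card {b \<in> B. R a b}}"
  have "card ?A * y = (\<Sum>a\<in>?A. y)" by simp
  also have "\<dots> \<le> (\<Sum>a\<in>?A. card {b \<in> B. R a b})" by (rule sum_mono) auto
  also have "\<dots> \<le> (\<Sum>a\<in>A. card {b \<in> B. R a b})"
    using assms by (intro sum_mono2) auto
  also have "\<dots> = (\<Sum>b\<in>B. card {a \<in> A. R a b})"
    using assms by (intro sum_multicount_gen) auto
  also have "\<dots> \<le> (\<Sum>b\<in>B. x)" using assms by (intro sum_mono) auto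
  finally show ?thesis by simp
qed

lemma exists_large_fibre:
  assumes "finite X" "finite Y" "f ` X \<subseteq> Y" "card Y * k < card X"
  obtains y where "y \<in> Y" "k < card {x \<in> X. f x = y}"
proof -
  have "\<exists>y\<in>Y. k < card {x \<in> X. f x = y}"
  proof (rule ccontr)
    assume "\<not> ?thesis"
    then have le: "card {x \<in> X. f x = y} \<le> k" if "y \<in> Y" for y
      using that by (meson not_less)
    have "card X = (\<Sum>y\<in>Y. card {x \<in> X. f x = y})"
      using sum.group[OF assms(1-3), of "\<lambda>_. 1::nat"] by simp
    also have "\<dots> \<le> (\<Sum>y\<in>Y. k)" using le by (rule sum_mono)
    finally show False using assms(4) by simp
  qed
  then show thesis using that by blast
qed

text \<open>Every chosen element rules out at most \<open>e\<close> elements of \<open>X\<close>, so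
  \<open>k * e < card X\<close> leaves room for \<open>k\<close> choices. Reflexivity makes a chosen
  element rule out itself, hence the next one is new. Used once to choose left vertices and once to
  choose right vertices.\<close>

lemma greedy_independent_set:
  assumes "finite X" "k * e < card X"
    and "\<And>x. x \<in> X \<Longrightarrow> card {y \<in> X. R x y} \<le> e"
    and refl: "\<And>x. x \<in> X \<Longrightarrow> R x x"
    and sym: "\<And>x y. R x y \<Longrightarrow> R y x"
  shows "\<exists>S. S \<subseteq> X \<and> card S = k \<and> (\<forall>x\<in>S. \<forall>y\<in>S. x \<noteq> y \<longrightarrow> \<not> R x y)"
  using assms(2)
proof (induction k)
  case 0
  then show ?case by (intro exI[of _ "{}"]) auto
next
  case (Suc k)
  then obtain S where S: "S \<subseteq> X" "card S = k" "\<forall>x\<in>S. \<forall>y\<in>S. x \<noteq> y \<longrightarrow> \<not> R x y"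
    by auto
  have fS: "finite S" using S assms(1) finite_subset by blast
  let ?U = "\<Union>x\<in>S. {y \<in> X. R x y}"
  have "card ?U \<le> (\<Sum>x\<in>S. card {y \<in> X. R x y})" by (rule card_UN_le[OF fS])
  also have "\<dots> \<le> (\<Sum>x\<in>S. e)" using S assms(3) by (intro sum_mono) auto
  also have "\<dots> < card X" using S Suc.prems by simp
  finally have "\<not> X \<subseteq> ?U"
    using card_mono[of ?U X] fS assms(1) by auto
  then obtain z where z: "z \<in> X" "z \<notin> ?U" by blast
  have "z \<notin> S" using z refl by blast
  with S z sym fS show ?case
    by (intro exI[of _ "insert z S"]) auto
qed

section \<open>Monochromatic rectangles from colours that are dense at many vertices\<close>

text \<open>A Kovari-Sos-Turan style argument: elements of \<open>B\<close> have on average at least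
  \<open>2 * k\<close> neighbours in \<open>L\<close>, so at least \<open>m / 2\<close> of them have
  \<open>k\<close> or more. As \<open>L\<close> has only \<open>2 ^ (2 * q * k)\<close> subsets,
  more than \<open>k\<close> of these share the same neighbourhood.\<close>

lemma common_neighbourhood:
  fixes k q m :: nat
  assumes "finite L" "card L = 2 * q * k" "finite B" "card B \<le> q * m" "q > 0" "k > 0"
    and deg: "\<And>a. a \<in> L \<Longrightarrow> m \<le> card {b \<in> B. R a b}"
    and m: "2 * k * 2 ^ (2 * q * k) < m"
  obtains S T where "S \<subseteq> L" "T \<subseteq> B" "card S = k" "card T = k"
    "\<And>a b. a \<in> S \<Longrightarrow> b \<in> T \<Longrightarrow> R a b"
proof -
  let ?N = "\<lambda>b. {a \<in> L. R a b}"
  let ?X = "{b \<in> B. k \<le> card (?N b)}"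
  let ?M = "2 * q * k"
  have "?M * m = (\<Sum>a\<in>L. m)" using assms by simp
  also have "\<dots> \<le> (\<Sum>a\<in>L. card {b \<in> B. R a b})" using deg by (rule sum_mono)
  also have "\<dots> = (\<Sum>b\<in>B. card (?N b))"
    using assms by (intro sum_multicount_gen) auto
  \<comment> \<open>Outside \<open>?X\<close> a neighbourhood has fewer than \<open>k\<close>
    elements; inside, the trivial bound \<open>card L\<close> is enough.\<close>
  also have "\<dots> \<le> (\<Sum>b\<in>B. k + (if b \<in> ?X then ?M else 0))"
  proof (rule sum_mono)
    fix b assume "b \<in> B"
    moreover have "card (?N b) \<le> ?M"
      using card_mono[of L "?N b"] assms by auto
    ultimately show "card (?N b) \<le> k + (if b \<in> ?X then ?M else 0)" by auto
  qed
  also have "\<dots> = card B * k + ?M * card ?X"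
    using assms by (simp add: sum.distrib sum.If_cases Int_def)
  also have "\<dots> \<le> q * m * k + ?M * card ?X" using assms by simp
  finally have "(q * k) * (2 * m) \<le> (q * k) * (m + 2 * card ?X)" by (simp add: algebra_simps)
  then have "m \<le> 2 * card ?X" using assms by simp
  then have "card (Pow L) * k < card ?X"
    using m assms by (simp add: card_Pow algebra_simps)
  then obtain S' where S': "S' \<in> Pow L" "k < card {b \<in> ?X. ?N b = S'}"
    using exists_large_fibre[of ?X "Pow L" ?N k] assms by auto
  \<comment> \<open>The fibre is nonempty, so \<open>S'\<close> is the neighbourhood of a member of
    \<open>?X\<close> and therefore has at least \<open>k\<close> elements.\<close>
  then have "{b \<in> ?X. ?N b = S'} \<noteq> {}" by (metis card.empty not_less0)
  then obtain b where "b \<in> ?X" "?N b = S'" by blast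
  then have "k \<le> card S'" by auto
  then obtain S where S: "S \<subseteq> S'" "card S = k" by (meson obtain_subset_with_card_n)
  obtain T where T: "T \<subseteq> {b \<in> ?X. ?N b = S'}" "card T = k"
    by (rule obtain_subset_with_card_n[OF less_imp_le[OF S'(2)]])
  have "R a b" if "a \<in> S" "b \<in> T" for a b
    using that S(1) T(1) by blast
  moreover have "S \<subseteq> L" "T \<subseteq> B" using S(1) S'(1) T(1) by blast+
  ultimately show thesis using that S(2) T(2) by metis
qed

text \<open>The colouring is treated as a matrix with left vertices as rows and right vertices as
  columns, so that exchanging the two sides is transposition. Both sides of the rectangle have equal
  size, which makes the notion symmetric under it.\<close>

definition mono_rectangle :: "(nat \<Rightarrow> nat \<Rightarrow> nat) \<Rightarrow> nat \<Rightarrow> nat \<Rightarrow> bool" where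
  "mono_rectangle f n k \<longleftrightarrow> (\<exists>S T i. S \<subseteq> {..<n} \<and> T \<subseteq> {..<n} \<and> card S = k \<and> card T = k \<and>
     (\<forall>a\<in>S. \<forall>b\<in>T. f a b = i))"

definition rainbow_rectangle :: "(nat \<Rightarrow> nat \<Rightarrow> nat) \<Rightarrow> nat \<Rightarrow> nat \<Rightarrow> bool" where
  "rainbow_rectangle f n k \<longleftrightarrow> (\<exists>S T. S \<subseteq> {..<n} \<and> T \<subseteq> {..<n} \<and> card S = k \<and> card T = k \<and>
     inj_on (\<lambda>(a, b). f a b) (S \<times> T))"

lemma mono_rectangle_swap: "mono_rectangle (\<lambda>a b. f b a) n k \<Longrightarrow> mono_rectangle f n k"
  unfolding mono_rectangle_def by metis

text \<open>With more such vertices, pigeonhole over the \<open>r\<close> colours finds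
  \<open>2 * q * k\<close> of them dense in one common colour, and
  \<open>common_neighbourhood\<close> applies to that colour class.\<close>

lemma card_colour_dense_vertices_le:
  fixes q m k r :: nat
  assumes "\<And>a b. a < n \<Longrightarrow> b < n \<Longrightarrow> f a b < r"
    and "n = q * m" "q > 0" "k > 0" "2 * k * 2 ^ (2 * q * k) < m"
    and no_mono: "\<not> mono_rectangle f n k"
  shows "card {a \<in> {..<n}. \<exists>i. m < card {b \<in> {..<n}. f a b = i}} \<le> r * (2 * q * k)"
proof (rule ccontr)
  let ?X = "{a \<in> {..<n}. \<exists>i. m < card {b \<in> {..<n}. f a b = i}}"
  assume "\<not> card ?X \<le> r * (2 * q * k)"
  then have big: "card {..<r} * (2 * q * k) < card ?X" by simp
  define g where "g a = (SOME i. m < card {b \<in> {..<n}. f a b = i})" for a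
  have g: "m < card {b \<in> {..<n}. f a b = g a}" if "a \<in> ?X" for a
    using that unfolding g_def by (auto intro: someI_ex)
  have "g ` ?X \<subseteq> {..<r}"
  proof (rule image_subsetI)
    fix a assume a: "a \<in> ?X"
    \<comment> \<open>The choice of \<open>g a\<close> ranges over all naturals; it is below
      \<open>r\<close> because some edge at \<open>a\<close> has this colour.\<close>
    have "{b \<in> {..<n}. f a b = g a} \<noteq> {}"
      using g[OF a] by (metis card.empty not_less0)
    then obtain b where "b < n" "f a b = g a" by auto
    then show "g a \<in> {..<r}" using assms(1)[of a b] a by simp
  qed
  then obtain i where i: "2 * q * k < card {a \<in> ?X. g a = i}"
    by (rule exists_large_fibre[OF _ _ _ big, rotated 2]) auto
  obtain L where L: "L \<subseteq> {a \<in> ?X. g a = i}" "card L = 2 * q * k" "finite L"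
    using obtain_subset_with_card_n[OF less_imp_le[OF i]] by blast
  obtain S T where ST: "S \<subseteq> L" "T \<subseteq> {..<n}" "card S = k" "card T = k"
    "\<And>a b. a \<in> S \<Longrightarrow> b \<in> T \<Longrightarrow> f a b = i"
  proof (rule common_neighbourhood[of L q k "{..<n}" m "\<lambda>a b. f a b = i"])
    fix a assume "a \<in> L"
    then have "a \<in> ?X" "g a = i" using L(1) by blast+
    then show "m \<le> card {b \<in> {..<n}. f a b = i}" using g by fastforce
  qed (use assms L in auto)
  have "S \<subseteq> {..<n}" using ST(1) L(1) by blast
  then have "mono_rectangle f n k" unfolding mono_rectangle_def using ST(2-5) by metis
  with no_mono show False ..
qed

section \<open>Rainbow rectangles when every colour is rare\<close>

text \<open>All losses are measured in units of \<open>D * m\<close>, of which each side has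
  \<open>D\<close>. Discarding colour-dense vertices costs at most one unit on each side. Choosing
  rows needs \<open>k + 1 < D\<close>; for columns, \<open>D\<close> provides \<open>k ^ 2\<close>
  units for coincidences between rows, one for \<open>Q\<close>, and \<open>k ^ 3 + 1\<close> for
  the greedy choice.\<close>

lemma rainbow_rectangle_if_no_mono_rectangle:
  fixes D m k r :: nat
  assumes col: "\<And>a b. a < n \<Longrightarrow> b < n \<Longrightarrow> f a b < r"
    and k: "k > 0" and D: "D = k ^ 3 + k ^ 2 + 2" and n: "n = D * D * m"
    and m: "2 * k * 2 ^ (2 * (D * D) * k) < m" and rm: "r * (2 * (D * D) * k) \<le> D * m"
    and nm: "\<not> mono_rectangle f n k"
  shows "rainbow_rectangle f n k"
proof -
  define P where "P = {a \<in> {..<n}. \<exists>i. m < card {b \<in> {..<n}. f a b = i}}"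
  define Q where "Q = {b \<in> {..<n}. \<exists>i. m < card {a \<in> {..<n}. f a b = i}}"
  define A where "A = {..<n} - P"
  define B where "B = {..<n} - Q"
  have m0: "m > 0" using m by simp
  have D0: "D > 0" "k + 1 < D"
    using k D self_le_power[of k 3] self_le_power[of k 2] by auto
  have fin[simp]: "finite A" "finite B" by (auto simp: A_def B_def)
  have "card P \<le> D * m" unfolding P_def
    using card_colour_dense_vertices_le[of n f r "D * D" m k] assms nm rm D0
    by (meson le_trans mult_pos_pos)
  then have cA: "D * D * m - D * m \<le> card A"
    unfolding A_def using n by (subst card_Diff_subset) (auto simp: P_def)
  have "\<not> mono_rectangle (\<lambda>b a. f a b) n k" using nm mono_rectangle_swap by blast
  then have "card Q \<le> D * m" unfolding Q_def
    using card_colour_dense_vertices_le[of n "\<lambda>b a. f a b" r "D * D" m k] assms rm D0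
    by (meson le_trans mult_pos_pos)
  then have cB: "D * D * m - D * m \<le> card B"
    unfolding B_def using n by (subst card_Diff_subset) (auto simp: Q_def)
  have cB': "card B \<le> D * D * m" using card_mono[of "{..<n}" B] n by (auto simp: B_def)
  have rareA: "card {b \<in> {..<n}. f a b = i} \<le> m" if "a \<in> A" for a i
    using that by (auto simp: A_def P_def not_less)
  have rareB: "card {a \<in> {..<n}. f a b = i} \<le> m" if "b \<in> B" for b i
    using that by (auto simp: B_def Q_def not_less)

  \<comment> \<open>Two rows conflict if they agree in at least \<open>D * m\<close> columns of
    \<open>B\<close>. Columns of \<open>B\<close> see every colour at most \<open>m\<close> times,
    so double counting bounds the conflicts of a row by \<open>D * m\<close>.\<close>
  let ?coin = "\<lambda>a a'. {b \<in> B. f a b = f a' b}"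
  have Dk: "D * m * (k + 2) \<le> D * m * D" using D0 by (intro mult_le_mono2) simp
  have "\<exists>S. S \<subseteq> A \<and> card S = k \<and> (\<forall>x\<in>S. \<forall>y\<in>S. x \<noteq> y \<longrightarrow> \<not> D * m \<le> card (?coin x y))"
  proof (rule greedy_independent_set)
    have "k * (D * m) + D * m < D * D * m"
    proof -
      have "D * m > 0" using m0 D0 by simp
      moreover have "D * m * (k + 2) = k * (D * m) + D * m + D * m" "D * m * D = D * D * m"
        by (simp_all add: algebra_simps)
      ultimately show ?thesis using Dk by linarith
    qed
    then show "k * (D * m) < card A" using cA by linarith
  next
    fix a assume a: "a \<in> A"
    have "card {a' \<in> A. D * m \<le> card (?coin a a')} * (D * m) \<le> card B * m"
    proof (rule card_dense_mult_le)
      fix b assume b: "b \<in> B"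
      have "card {a' \<in> A. f a b = f a' b} \<le> card {a' \<in> {..<n}. f a' b = f a b}"
        by (rule card_mono) (auto simp: A_def)
      also have "\<dots> \<le> m" using rareB b by blast
      finally show "card {a' \<in> A. f a b = f a' b} \<le> m" .
    qed auto
    also have "\<dots> \<le> D * m * (D * m)" using cB' by (simp add: algebra_simps)
    finally show "card {a' \<in> A. D * m \<le> card (?coin a a')} \<le> D * m"
      using m0 D0 by simp
  next
    fix a assume "a \<in> A"
    \<comment> \<open>A row agrees with itself on all of \<open>B\<close>, so reflexivity only needs
      \<open>B\<close> to be large.\<close>
    have "D * m \<le> card B" using cB Dk D0 by (simp add: algebra_simps)
    then show "D * m \<le> card (?coin a a)" by simp
  next
    fix x y assume "D * m \<le> card (?coin x y)"
    then show "D * m \<le> card (?coin y x)" by (simp add: eq_commute)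
  qed auto
  then obtain S where S: "S \<subseteq> A" "card S = k"
    and coin: "\<And>x y. x \<in> S \<Longrightarrow> y \<in> S \<Longrightarrow> x \<noteq> y \<Longrightarrow> card (?coin x y) \<le> D * m"
    by (metis nat_le_linear)
  have fS: "finite S" using S finite_subset fin by blast

  \<comment> \<open>Keep the columns on which the chosen rows have distinct colours; each of at most
    \<open>k ^ 2\<close> ordered pairs of rows removes at most \<open>D * m\<close> columns.\<close>
  define X where "X = {b \<in> B. inj_on (\<lambda>a. f a b) S}"
  have "B - X \<subseteq> (\<Union>(x, y)\<in>{p \<in> S \<times> S. fst p \<noteq> snd p}. ?coin x y)"
    by (auto simp: X_def inj_on_def)
  then have "card (B - X) \<le> card (\<Union>(x, y)\<in>{p \<in> S \<times> S. fst p \<noteq> snd p}. ?coin x y)"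
    by (rule card_mono[rotated]) (use fS in auto)
  also have "\<dots> \<le> (\<Sum>p\<in>{p \<in> S \<times> S. fst p \<noteq> snd p}. card (case p of (x, y) \<Rightarrow> ?coin x y))"
    by (rule card_UN_le) (use fS in auto)
  also have "\<dots> \<le> (\<Sum>p\<in>{p \<in> S \<times> S. fst p \<noteq> snd p}. D * m)"
    by (rule sum_mono) (use coin in auto)
  also have "\<dots> \<le> card (S \<times> S) * (D * m)"
    using fS card_mono[of "S \<times> S" "{p \<in> S \<times> S. fst p \<noteq> snd p}"]
    by (simp only: sum_constant of_nat_id) (intro mult_le_mono1, auto)
  also have "\<dots> = k ^ 2 * (D * m)" using S by (simp add: card_cartesian_product power2_eq_square)
  finally have "card B \<le> card X + k ^ 2 * (D * m)"
    using card_Diff_subset[of X B] card_mono[of B X] by (auto simp: X_def)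
  then have cX: "D * D * m \<le> card X + k ^ 2 * (D * m) + D * m" using cB by linarith

  \<comment> \<open>Two columns now conflict if they share a colour on \<open>S\<close>. For each
    pair of rows \<open>a\<close>, \<open>a'\<close>, rarity of the colour \<open>f a b\<close> at
    \<open>a'\<close> allows at most \<open>m\<close> conflicting columns.\<close>
  have "\<exists>T. T \<subseteq> X \<and> card T = k \<and>
      (\<forall>b\<in>T. \<forall>b'\<in>T. b \<noteq> b' \<longrightarrow> \<not> (\<exists>a\<in>S. \<exists>a'\<in>S. f a b = f a' b'))"
  proof (rule greedy_independent_set)
    have "D * D * m = k ^ 3 * (D * m) + k ^ 2 * (D * m) + 2 * (D * m)"
      using D by (simp add: algebra_simps)
    then have "k ^ 3 * (D * m) + D * m \<le> card X" using cX by linarith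
    moreover have "k ^ 3 * m \<le> k ^ 3 * (D * m)" using D0 by simp
    moreover have "D * m > 0" using D0 m0 by simp
    moreover have "k * (k ^ 2 * m) = k ^ 3 * m" by (simp add: power_numeral_reduce)
    ultimately show "k * (k ^ 2 * m) < card X" by linarith
  next
    fix b assume b: "b \<in> X"
    have "card {b' \<in> X. \<exists>a\<in>S. \<exists>a'\<in>S. f a b = f a' b'}
        \<le> card (\<Union>(a, a')\<in>S \<times> S. {b' \<in> {..<n}. f a' b' = f a b})"
      by (rule card_mono) (use fS in \<open>auto simp: X_def B_def\<close>)
    also have "\<dots> \<le> (\<Sum>p\<in>S \<times> S. card (case p of (a, a') \<Rightarrow> {b' \<in> {..<n}. f a' b' = f a b}))"
      by (rule card_UN_le) (use fS in auto)
    also have "\<dots> \<le> (\<Sum>p\<in>S \<times> S. m)"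
      by (rule sum_mono) (use rareA S in auto)
    also have "\<dots> = k ^ 2 * m" using S by (simp add: card_cartesian_product power2_eq_square)
    finally show "card {b' \<in> X. \<exists>a\<in>S. \<exists>a'\<in>S. f a b = f a' b'} \<le> k ^ 2 * m" .
  next
    show "\<exists>a\<in>S. \<exists>a'\<in>S. f a b = f a' b" for b
      using S k by (metis card.empty ex_in_conv less_irrefl)
  qed (auto simp: X_def, metis)
  then obtain T where T: "T \<subseteq> X" "card T = k"
    "\<forall>b\<in>T. \<forall>b'\<in>T. b \<noteq> b' \<longrightarrow> \<not> (\<exists>a\<in>S. \<exists>a'\<in>S. f a b = f a' b')" by blast
  \<comment> \<open>Equal colours cannot occur in different columns by the choice of
    \<open>T\<close>, nor within one column by the definition of \<open>X\<close>.\<close>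
  have "inj_on (\<lambda>(a, b). f a b) (S \<times> T)"
  proof (rule inj_onI, clarify)
    fix a b a' b' assume *: "a \<in> S" "b \<in> T" "a' \<in> S" "b' \<in> T" "f a b = f a' b'"
    then have "b = b'" using T by blast
    moreover have "inj_on (\<lambda>a. f a b) S" using T * by (auto simp: X_def)
    ultimately show "a = a' \<and> b = b'" using * by (auto dest: inj_onD)
  qed
  moreover have "S \<subseteq> {..<n}" "T \<subseteq> {..<n}" using S T by (auto simp: A_def B_def X_def)
  ultimately show "rainbow_rectangle f n k"
    unfolding rainbow_rectangle_def using S T by blast
qed

section \<open>From rectangles back to copies of complete bipartite graphs\<close>

lemma copy_of_complete_bipartite:
  assumes "S \<subseteq> {..<n}" "T \<subseteq> {..<n}" "card S = s" "card T = t"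
  shows "copy_in (complete_bipartite s t) (complete_bipartite n n)
    \<lparr>vertices = Inl ` S \<union> Inr ` T, edges = {{Inl i, Inr j} | i j. i \<in> S \<and> j \<in> T}\<rparr>"
    (is "copy_in _ _ ?F")
proof -
  have fin: "finite S" "finite T" using assms finite_subset by blast+
  obtain g where g: "bij_betw g {..<s} S"
    using assms fin by (metis ex_bij_betw_nat_finite atLeast0LessThan)
  obtain h where h: "bij_betw h {..<t} T"
    using assms fin by (metis ex_bij_betw_nat_finite atLeast0LessThan)
  have gh: "inj_on g {..<s}" "g ` {..<s} = S" "inj_on h {..<t}" "h ` {..<t} = T"
    using g h by (auto simp: bij_betw_def)
  have "subgraph ?F (complete_bipartite n n)"
    using assms by (fastforce simp: subgraph_def simple_graph_def complete_bipartite_def)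
  moreover have "isomorphic (complete_bipartite s t) ?F"
    unfolding isomorphic_def
  proof (intro exI[of _ "map_sum g h"] conjI)
    show "bij_betw (map_sum g h) (vertices (complete_bipartite s t)) (vertices ?F)"
      unfolding bij_betw_def
    proof
      show "inj_on (map_sum g h) (vertices (complete_bipartite s t))"
        using gh by (auto simp: complete_bipartite_def inj_on_def)
      show "map_sum g h ` vertices (complete_bipartite s t) = vertices ?F"
        using gh(2,4) by (auto simp: complete_bipartite_def image_Un image_image)
    qed
    show "(\<lambda>e. map_sum g h ` e) ` edges (complete_bipartite s t) = edges ?F"
    proof
      show "(\<lambda>e. map_sum g h ` e) ` edges (complete_bipartite s t) \<subseteq> edges ?F"
        using gh by (fastforce simp: complete_bipartite_def)
      show "edges ?F \<subseteq> (\<lambda>e. map_sum g h ` e) ` edges (complete_bipartite s t)"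
      proof
        fix e assume "e \<in> edges ?F"
        then obtain i j where ij: "i < s" "j < t" "e = {Inl (g i), Inr (h j)}"
          using gh by auto
        then have "e = map_sum g h ` {Inl i, Inr j}" by simp
        then show "e \<in> (\<lambda>e. map_sum g h ` e) ` edges (complete_bipartite s t)"
          by (rule image_eqI) (use ij in \<open>auto simp: complete_bipartite_def\<close>)
      qed
    qed
  qed
  ultimately show ?thesis by (simp add: copy_in_def)
qed

theorem theorem1:
  fixes s t :: nat
  assumes "s > 0" and "t > 0"
  shows "\<exists>C::nat. C > 0 \<and>
    (\<forall>r::nat. r > 0 \<longrightarrow>
      (\<forall>c. edge_coloring r (complete_bipartite (C * r) (C * r)) c \<longrightarrow>
        (\<exists>F. copy_in (complete_bipartite s t) (complete_bipartite (C * r) (C * r)) F \<and>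
             (monochromatic c F \<or> rainbow c F))))"
proof -
  \<comment> \<open>The lemmas are applied with \<open>m = E * r\<close>. The summand 1 in
    \<open>E\<close> gives the strict bound on \<open>m\<close>, and the exponential dominates
    \<open>2 * (D * D) * k\<close>, which controls the number of colour-dense vertices.\<close>
  define k where "k = max s t"
  define D where "D = k ^ 3 + k ^ 2 + 2"
  define E where "E = 2 * k * 2 ^ (2 * (D * D) * k) + 1"
  define C where "C = D * D * E"
  have k: "k > 0" "s \<le> k" "t \<le> k" using assms by (auto simp: k_def)
  have D0: "D > 0" by (simp add: D_def)
  have "2 * (D * D) * k \<le> E"
  proof -
    have "2 * (D * D) * k \<le> 2 ^ (2 * (D * D) * k)" by (rule less_imp_le[OF less_exp])
    also have "\<dots> \<le> 2 * k * 2 ^ (2 * (D * D) * k)" using k by simp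
    finally show ?thesis unfolding E_def by linarith
  qed
  also have "E \<le> D * E" using D0 by simp
  finally have ME: "2 * (D * D) * k \<le> D * E" .
  show ?thesis
  proof (intro exI[of _ C] conjI allI impI)
    show "C > 0" using D0 by (simp add: C_def E_def)
    fix r :: nat and c
    assume r: "r > 0" and c: "edge_coloring r (complete_bipartite (C * r) (C * r)) c"
    define n where "n = C * r"
    define f where "f a b = c {Inl a, Inr b}" for a b :: nat
    have "rainbow_rectangle f n k" if "\<not> mono_rectangle f n k"
    proof (rule rainbow_rectangle_if_no_mono_rectangle)
      show "f a b < r" if "a < n" "b < n" for a b
        using c that by (auto simp: edge_coloring_def complete_bipartite_def f_def n_def Pi_iff)
      show "n = D * D * (E * r)" by (simp add: n_def C_def)
      have "2 * k * 2 ^ (2 * (D * D) * k) < E" by (simp add: E_def)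
      also have "E \<le> E * r" using r by simp
      finally show "2 * k * 2 ^ (2 * (D * D) * k) < E * r" .
      show "r * (2 * (D * D) * k) \<le> D * (E * r)"
        using mult_le_mono1[OF ME, of r] by (simp add: algebra_simps)
    qed (use k D_def that in auto)
    then obtain S T where ST: "S \<subseteq> {..<n}" "T \<subseteq> {..<n}" "card S = k" "card T = k"
      "(\<exists>i. \<forall>a\<in>S. \<forall>b\<in>T. f a b = i) \<or> inj_on (\<lambda>(a, b). f a b) (S \<times> T)"
      unfolding mono_rectangle_def rainbow_rectangle_def by blast
    \<comment> \<open>Trimming the square rectangle to size \<open>s\<close> by \<open>t\<close>
      preserves being constant as well as being injective.\<close>
    obtain S' where S': "S' \<subseteq> S" "card S' = s"
      using ST(3) k(2) obtain_subset_with_card_n[of s S] by metis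
    obtain T' where T': "T' \<subseteq> T" "card T' = t"
      using ST(4) k(3) obtain_subset_with_card_n[of t T] by metis
    let ?F = "\<lparr>vertices = Inl ` S' \<union> Inr ` T', edges = {{Inl i, Inr j} | i j. i \<in> S' \<and> j \<in> T'}\<rparr>"
    have "copy_in (complete_bipartite s t) (complete_bipartite n n) ?F"
      using ST S' T' by (intro copy_of_complete_bipartite) auto
    moreover have "monochromatic c ?F \<or> rainbow c ?F"
      using ST(5)
    proof
      assume "\<exists>i. \<forall>a\<in>S. \<forall>b\<in>T. f a b = i"
      then obtain i where "\<And>a b. a \<in> S' \<Longrightarrow> b \<in> T' \<Longrightarrow> c {Inl a, Inr b} = i"
        using S' T' unfolding f_def by blast
      then have "monochromatic c ?F" by (auto simp: monochromatic_def)
      then show ?thesis ..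
    next
      assume inj: "inj_on (\<lambda>(a, b). f a b) (S \<times> T)"
      have "rainbow c ?F"
        unfolding rainbow_def
      proof (rule inj_onI)
        fix e e' assume "e \<in> edges ?F" "e' \<in> edges ?F" and eq: "c e = c e'"
        then obtain a b a' b' where *: "a \<in> S'" "b \<in> T'" "a' \<in> S'" "b' \<in> T'"
          "e = {Inl a, Inr b}" "e' = {Inl a', Inr b'}" by auto
        then have "(a, b) = (a', b')"
          using inj_onD[OF inj, of "(a, b)" "(a', b')"] eq S' T' by (auto simp: f_def)
        then show "e = e'" using * by simp
      qed
      then show ?thesis ..
    qed
    ultimately show "\<exists>F. copy_in (complete_bipartite s t) (complete_bipartite (C * r) (C * r)) F \<and>
             (monochromatic c F \<or> rainbow c F)"
      unfolding n_def by blast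
  qed
qed

end
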